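(* For any choice of $\nu>0$, $0<\kappa<1$, $S>0$ and $\eta>0$ there exist unique values $\Xi>0$ and $\sigma<0$ (with $\sigma$ admissible for $\Xi$) such that the traveling wave $V=V_{\Xi,\sigma}$ satisfies $$V(X)=\eta\,\exp\bigl(\lambda_+\,(X+\Xi)\bigr)\qquad\text{for all } X\le-\Xi$$ as well as $A_-=0<A_+$, $\;B_-<0<B_+$ and $C_->0$, $C_+>0$.
   Context: Background: one considers increasing traveling waves $u(t,x)=U(x+St)$, $S>0$, of $\partial_t u-\nu^2\partial_x^2\partial_t u=\partial_x^2\Phi'(u)$, where $\Phi'(u)=u+1$ for $u\le-\kappa$, $\Phi'(u)=-\frac{1-\kappa}{\kappa}u$ for $-\kappa\le u\le\kappa$, $\Phi'(u)=u-1$ for $u\ge\kappa$. The function $V$ is the derivative $U'$ of a profile with $U(\pm\Xi)=\pm\kappa$. Intervals: for $\Xi>0$ let $I_-=(-\infty,-\Xi]$, $I_0=[-\Xi,\Xi]$, $I_+=[\Xi,\infty)$. Exponential rates: $$\lambda_\pm=-\frac{1}{2\nu^2S}\pm\sqrt{\Bigl(\frac{1}{2\nu^2S}\Bigr)^2+\frac1{\nu^2}},\qquad \mu_\pm=\frac{1-\kappa}{2\nu^2S\kappa}\pm\sqrt{\Bigl(\frac{1-\kappa}{2\nu^2S\kappa}\Bigr)^2+\frac1{\nu^2}}.$$ Auxiliary quantities: $$\tau_{--}=-\lambda_-+\mu_--\tfrac{1}{\nu^2S\kappa},\quad \tau_{-+}=-\lambda_-+\mu_+-\tfrac{1}{\nu^2S\kappa},\quad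 \tau_{+-}=-\lambda_++\mu_--\tfrac{1}{\nu^2S\kappa},\quad \tau_{++}=-\lambda_++\mu_+-\tfrac{1}{\nu^2S\kappa}.$$ Traveling wave problem (with parameters $\nu,\kappa,S,\Xi$): a solution is a continuous function $V:\mathbb{R}\to\mathbb{R}$ that satisfies $$S\,V-\nu^2S\,V''=\bigl(V-c\,V\bigr)'$$ in the weak (distributional) sense on $\mathbb{R}$, where $c(X)=1/\kappa$ for $X\in I_0$ and $c(X)=0$ otherwise, and that satisfies the constraints $V(X)\ge0$ for all $X\in\mathbb{R}$ and $\int_{-\Xi}^{\Xi}V(X)\,dX=2\kappa$. Equivalently to the weak equation, $V$ is continuous, has the form $$V(X)=\begin{cases}A_-e^{\lambda_-X}+A_+e^{\lambda_+X}&X\in I_-,\\ B_-e^{\mu_-X}+B_+e^{\mu_+X}&X\in I_0,\\ C_-e^{\lambda_-X}+C_+e^{\lambda_+X}&X\in I_+,\end{cases}$$ with real coefficients $A_\pm,B_\pm,C_\pm$, and the one-sided derivatives satisfy $V'(-\Xi-0)=V'(-\Xi+0)-\frac{1}{\nu^2S\kappa}V(-\Xi)$ and $V'(\Xi+0)=V'(\Xi-0)-\frac{1}{\nu^2S\kappa}V(\Xi)$. The coefficients $A_\pm,B_\pm,C_\pm$ in the claim are those of this representation. A number $\sigma$ is called admissible for $\Xi$ (given $\nu,\kappa,S$) if $$-\frac{\tau_{++}}{\tau_{+-}}\,e^{-(\mu_+-\mu_-)\Xi}\le\sigma\le-\frac{\tau_{-+}}{\tau_{--}}\,e^{(\mu_+-\mu_-)\Xi}.$$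 For $\Xi>0$ and $\sigma$ admissible for $\Xi$, $V_{\Xi,\sigma}$ denotes the unique solution of the traveling wave problem with parameters $\nu,\kappa,S,\Xi$ that satisfies $B_-=\sigma B_+$ and $B_+>0$ (it exists, is unique and strictly positive, and every solution of the traveling wave problem is of this form). *)

theory Defs
  imports "HOL-Analysis.Analysis"
begin

definition lam_minus :: "real \<Rightarrow> real \<Rightarrow> real" where
  "lam_minus \<nu> S = - 1 / (2 * \<nu>\<^sup>2 * S) - sqrt ((1 / (2 * \<nu>\<^sup>2 * S))\<^sup>2 + 1 / \<nu>\<^sup>2)"

definition lam_plus :: "real \<Rightarrow> real \<Rightarrow> real" where
  "lam_plus \<nu> S = - 1 / (2 * \<nu>\<^sup>2 * S) + sqrt ((1 / (2 * \<nu>\<^sup>2 * S))\<^sup>2 + 1 / \<nu>\<^sup>2)"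

definition mu_minus :: "real \<Rightarrow> real \<Rightarrow> real \<Rightarrow> real" where
  "mu_minus \<nu> \<kappa> S =
     (1 - \<kappa>) / (2 * \<nu>\<^sup>2 * S * \<kappa>) - sqrt (((1 - \<kappa>) / (2 * \<nu>\<^sup>2 * S * \<kappa>))\<^sup>2 + 1 / \<nu>\<^sup>2)"

definition mu_plus :: "real \<Rightarrow> real \<Rightarrow> real \<Rightarrow> real" where
  "mu_plus \<nu> \<kappa> S =
     (1 - \<kappa>) / (2 * \<nu>\<^sup>2 * S * \<kappa>) + sqrt (((1 - \<kappa>) / (2 * \<nu>\<^sup>2 * S * \<kappa>))\<^sup>2 + 1 / \<nu>\<^sup>2)"

text \<open>In \<open>tau_mp\<close> etc. the first sign refers to the rate \<open>lam\<close>, the second one to \<open>mu\<close>.\<close>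

definition tau_mm :: "real \<Rightarrow> real \<Rightarrow> real \<Rightarrow> real" where
  "tau_mm \<nu> \<kappa> S = - lam_minus \<nu> S + mu_minus \<nu> \<kappa> S - 1 / (\<nu>\<^sup>2 * S * \<kappa>)"

definition tau_mp :: "real \<Rightarrow> real \<Rightarrow> real \<Rightarrow> real" where
  "tau_mp \<nu> \<kappa> S = - lam_minus \<nu> S + mu_plus \<nu> \<kappa> S - 1 / (\<nu>\<^sup>2 * S * \<kappa>)"

definition tau_pm :: "real \<Rightarrow> real \<Rightarrow> real \<Rightarrow> real" where
  "tau_pm \<nu> \<kappa> S = - lam_plus \<nu> S + mu_minus \<nu> \<kappa> S - 1 / (\<nu>\<^sup>2 * S * \<kappa>)"

definition tau_pp :: "real \<Rightarrow> real \<Rightarrow> real \<Rightarrow> real" where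
  "tau_pp \<nu> \<kappa> S = - lam_plus \<nu> S + mu_plus \<nu> \<kappa> S - 1 / (\<nu>\<^sup>2 * S * \<kappa>)"

definition admissible :: "real \<Rightarrow> real \<Rightarrow> real \<Rightarrow> real \<Rightarrow> real \<Rightarrow> bool" where
  "admissible \<nu> \<kappa> S \<Xi> \<sigma> \<longleftrightarrow>
     - (tau_pp \<nu> \<kappa> S / tau_pm \<nu> \<kappa> S) * exp (- (mu_plus \<nu> \<kappa> S - mu_minus \<nu> \<kappa> S) * \<Xi>) \<le> \<sigma> \<and>
     \<sigma> \<le> - (tau_mp \<nu> \<kappa> S / tau_mm \<nu> \<kappa> S) * exp ((mu_plus \<nu> \<kappa> S - mu_minus \<nu> \<kappa> S) * \<Xi>)"

definition coef :: "real \<Rightarrow> real \<Rightarrow> real \<Rightarrow> real" where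
  "coef \<kappa> \<Xi> X = (if X \<in> {-\<Xi>..\<Xi>} then 1 / \<kappa> else 0)"

definition test_function :: "(real \<Rightarrow> real) \<Rightarrow> bool" where
  "test_function \<phi> \<longleftrightarrow>
     (\<forall>n x. (deriv ^^ n) \<phi> field_differentiable at x) \<and> compact (closure {x. \<phi> x \<noteq> 0})"

text \<open>
  \<open>S V - \<nu>\<^sup>2 S V'' = (V - c V)'\<close> in the sense of distributions, that is, with all derivatives
  moved to the test function.
\<close>

definition weak_wave_equation ::
    "real \<Rightarrow> real \<Rightarrow> real \<Rightarrow> real \<Rightarrow> (real \<Rightarrow> real) \<Rightarrow> bool" where
  "weak_wave_equation \<nu> \<kappa> S \<Xi> V \<longleftrightarrow>
     (\<forall>\<phi>. test_function \<phi> \<longrightarrow>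
        (LBINT X. S * V X * \<phi> X - \<nu>\<^sup>2 * S * V X * deriv (deriv \<phi>) X) =
        - (LBINT X. (V X - coef \<kappa> \<Xi> X * V X) * deriv \<phi> X))"

definition traveling_wave ::
    "real \<Rightarrow> real \<Rightarrow> real \<Rightarrow> real \<Rightarrow> (real \<Rightarrow> real) \<Rightarrow> bool" where
  "traveling_wave \<nu> \<kappa> S \<Xi> V \<longleftrightarrow>
     continuous_on UNIV V \<and> weak_wave_equation \<nu> \<kappa> S \<Xi> V \<and>
     (\<forall>X. V X \<ge> 0) \<and> (LBINT X:{-\<Xi>..\<Xi>}. V X) = 2 * \<kappa>"

definition has_coefficients ::
    "real \<Rightarrow> real \<Rightarrow> real \<Rightarrow> real \<Rightarrow> (real \<Rightarrow> real) \<Rightarrow>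
     real \<Rightarrow> real \<Rightarrow> real \<Rightarrow> real \<Rightarrow> real \<Rightarrow> real \<Rightarrow> bool" where
  "has_coefficients \<nu> \<kappa> S \<Xi> V Am Ap Bm Bp Cm Cp \<longleftrightarrow>
     (\<forall>X\<in>{..-\<Xi>}. V X = Am * exp (lam_minus \<nu> S * X) + Ap * exp (lam_plus \<nu> S * X)) \<and>
     (\<forall>X\<in>{-\<Xi>..\<Xi>}. V X = Bm * exp (mu_minus \<nu> \<kappa> S * X) + Bp * exp (mu_plus \<nu> \<kappa> S * X)) \<and>
     (\<forall>X\<in>{\<Xi>..}. V X = Cm * exp (lam_minus \<nu> S * X) + Cp * exp (lam_plus \<nu> S * X))"

definition is_wave ::
    "real \<Rightarrow> real \<Rightarrow> real \<Rightarrow> real \<Rightarrow> real \<Rightarrow> (real \<Rightarrow> real) \<Rightarrow> bool" where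
  "is_wave \<nu> \<kappa> S \<Xi> \<sigma> V \<longleftrightarrow>
     traveling_wave \<nu> \<kappa> S \<Xi> V \<and>
     (\<exists>Am Ap Bm Bp Cm Cp. has_coefficients \<nu> \<kappa> S \<Xi> V Am Ap Bm Bp Cm Cp \<and> Bm = \<sigma> * Bp \<and> Bp > 0)"

text \<open>Meaningful only where a unique solution exists, i.e. for \<open>\<Xi> > 0\<close> and admissible \<open>\<sigma>\<close>.\<close>

definition wave :: "real \<Rightarrow> real \<Rightarrow> real \<Rightarrow> real \<Rightarrow> real \<Rightarrow> real \<Rightarrow> real" where
  "wave \<nu> \<kappa> S \<Xi> \<sigma> = (THE V. is_wave \<nu> \<kappa> S \<Xi> \<sigma> V)"

end

theory Submission
  imports Defs
begin

text \<open>
  A continuous function that is a sum of two exponentials on each of the three intervals solves the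
  wave equation weakly exactly when its derivative jumps by \<open>V / (\<nu>\<^sup>2 S \<kappa>)\<close> at \<open>-\<Xi>\<close> and by
  \<open>-V / (\<nu>\<^sup>2 S \<kappa>)\<close> at \<open>\<Xi>\<close> (\<open>weak_wave_equation_iff_jumps\<close>): integration by parts on the pieces
  leaves only boundary terms at \<open>\<plusminus>\<Xi>\<close>, and a smooth bump that is positive at one of the two points
  and vanishes at the other isolates the term of the former.  The rest is a study of a linear
  initial value problem running from left to right.

  The prescribed tail \<open>\<eta> exp (\<lambda>\<^sub>+ (X + \<Xi>))\<close> fixes value \<open>\<eta>\<close> and slope \<open>\<lambda>\<^sub>+ \<eta>\<close> at \<open>-\<Xi> - 0\<close>, and the jump
  condition then fixes the Cauchy data at \<open>-\<Xi> + 0\<close>.  Consequently, as a function of the distance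
  \<open>t = X + \<Xi>\<close> from the left interface, the inner piece is one function \<open>w\<close> that does not depend on
  \<open>\<Xi>\<close>; its two coefficients are \<open>\<eta> \<tau>\<^sub>+\<^sub>+ / (\<mu>\<^sub>+ - \<mu>\<^sub>-)\<close> and \<open>-\<eta> \<tau>\<^sub>+\<^sub>- / (\<mu>\<^sub>+ - \<mu>\<^sub>-)\<close>.  This has two
  consequences (\<open>growing_wave_determined\<close>).  The ratio \<open>\<sigma>\<close> must be the lower end point of the
  admissible interval, and the integral constraint becomes \<open>\<integral>\<^sub>0\<^bsup>2\<Xi>\<^esup> w = 2 \<kappa>\<close>.  The signs of
  the \<open>\<tau>\<close> (\<open>tau_signs\<close>) make both terms of \<open>w\<close> increasing, so \<open>w \<ge> w 0 = \<eta>\<close>; the integral grows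
  strictly and at least linearly, hence attains \<open>2 \<kappa>\<close> for exactly one \<open>\<Xi>\<close> (\<open>mass_unique_level\<close>).

  Conversely, for this \<open>\<Xi>\<close> the inner piece continues past \<open>\<Xi>\<close> by the second jump condition, and the
  signs of the \<open>\<tau>\<close> make both outgoing coefficients positive; so the function constructed is
  nonnegative and is a wave (\<open>growing_wave_exists\<close>).  That it is the one selected by the definite
  description in \<open>wave\<close> follows from \<open>is_wave_unique\<close>.
\<close>

section \<open>Compactly supported smooth test functions\<close>

text \<open>
  The polynomial \<open>p\<close> and the exponent \<open>k\<close> make the family closed under differentiation, so that
  smoothness reduces to a single derivative computation.  The case \<open>p = 1\<close>, \<open>k = 0\<close> is the classical
  bump on \<open>(a, b)\<close>.
\<close>

definition bump :: "real \<Rightarrow> real \<Rightarrow> real poly \<Rightarrow> nat \<Rightarrow> real \<Rightarrow> real" where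
  "bump a b p k x =
     (if a < x \<and> x < b then poly p x / ((x - a) * (b - x)) ^ k * exp (- 1 / ((x - a) * (b - x))) else 0)"

text \<open>
  With \<open>y = 1/q\<close> this is the bound of \<open>exp y\<close> from below by one term of its power series.  It says
  that the exponential factor of a bump beats every power in the denominator.
\<close>

lemma exp_minus_inverse_le:
  fixes q :: real
  assumes "q > 0"
  shows "exp (- 1 / q) \<le> fact n * q ^ n"
proof -
  have sums: "(\<lambda>m. (1 / q) ^ m /\<^sub>R fact m) sums exp (1 / q)" by (rule exp_converges)
  have "(1 / q) ^ n /\<^sub>R fact n \<le> exp (1 / q)"
    using sum_le_suminf[OF sums_summable[OF sums], of "{n}"] assms sums_unique[OF sums] by simp
  then show ?thesis
    using assms by (simp add: exp_minus power_divide divide_simps mult_ac)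
qed

lemma DERIV_zero_if_quadratic_bound:
  fixes f :: "real \<Rightarrow> real"
  assumes bound: "\<And>x. \<bar>f x\<bar> \<le> K * (x - x0)\<^sup>2"
  shows "(f has_real_derivative 0) (at x0)"
proof -
  have f0: "f x0 = 0" using bound[of x0] by simp
  have "((\<lambda>x. (f x - f x0) / (x - x0)) \<longlongrightarrow> 0) (at x0)"
  proof (rule Lim_null_comparison)
    show "\<forall>\<^sub>F x in at x0. norm ((f x - f x0) / (x - x0)) \<le> K * \<bar>x - x0\<bar>"
    proof (rule eventually_mono[OF eventually_neq_at_within[of x0]])
      fix x assume "x \<noteq> x0"
      moreover have "\<bar>f x\<bar> \<le> K * \<bar>x - x0\<bar> * \<bar>x - x0\<bar>"
        using bound[of x] by (simp add: power2_eq_square mult.assoc)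
      ultimately show "norm ((f x - f x0) / (x - x0)) \<le> K * \<bar>x - x0\<bar>"
        by (simp add: f0 pos_divide_le_eq)
    qed
    show "((\<lambda>x. K * \<bar>x - x0\<bar>) \<longlongrightarrow> 0) (at x0)"
      by (auto intro!: tendsto_eq_intros)
  qed
  then show ?thesis by (simp add: has_field_derivative_iff)
qed

text \<open>
  The exponential absorbs the denominator with two powers of the gap \<open>(x - a) (b - x)\<close> to spare, and
  the gap is at most the distance to any point outside the support times the length \<open>b - a\<close>.
\<close>

lemma bump_quadratic_bound:
  assumes x0: "\<not> (a < x0 \<and> x0 < b)"
  shows "\<exists>K. \<forall>x. \<bar>bump a b p k x\<bar> \<le> K * (x - x0)\<^sup>2"
proof -
  have "bounded (poly p ` {a..b})"
    by (intro compact_imp_bounded compact_continuous_image continuous_intros) auto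
  then obtain M where M: "M > 0" "\<And>x. x \<in> {a..b} \<Longrightarrow> \<bar>poly p x\<bar> \<le> M"
    by (auto simp: bounded_pos)
  have "\<bar>bump a b p k x\<bar> \<le> M * fact (k + 2) * (b - a)\<^sup>2 * (x - x0)\<^sup>2" for x
  proof (cases "a < x \<and> x < b")
    case True
    define q where "q = (x - a) * (b - x)"
    have q: "q > 0" using True by (simp add: q_def)
    have "q \<le> \<bar>x - x0\<bar> * (b - a)"
    proof (cases "x0 \<le> a")
      case True
      then show ?thesis
        unfolding q_def using \<open>a < x \<and> x < b\<close> by (intro mult_mono) auto
    next
      case False
      then have "(b - x) * (x - a) \<le> \<bar>x - x0\<bar> * (b - a)"
        using \<open>a < x \<and> x < b\<close> x0 by (intro mult_mono) auto
      then show ?thesis by (simp add: q_def mult.commute)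
    qed
    then have "q\<^sup>2 \<le> (\<bar>x - x0\<bar> * (b - a))\<^sup>2"
      using q by (intro power_mono) auto
    then have q2: "q\<^sup>2 \<le> (b - a)\<^sup>2 * (x - x0)\<^sup>2"
      by (simp add: power_mult_distrib mult.commute)
    have "\<bar>bump a b p k x\<bar> = \<bar>poly p x\<bar> * (exp (- 1 / q) / q ^ k)"
      using True q by (simp add: bump_def q_def abs_mult)
    also have "\<dots> \<le> M * (fact (k + 2) * q\<^sup>2)"
    proof (rule mult_mono)
      show "\<bar>poly p x\<bar> \<le> M" using M True by auto
      show "exp (- 1 / q) / q ^ k \<le> fact (k + 2) * q\<^sup>2"
        using exp_minus_inverse_le[OF q, of "k + 2"] q
        by (simp add: pos_divide_le_eq power_add power2_eq_square mult_ac)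
    qed (use M q in auto)
    also have "\<dots> \<le> M * (fact (k + 2) * ((b - a)\<^sup>2 * (x - x0)\<^sup>2))"
      using q2 M by (intro mult_left_mono) auto
    finally show ?thesis by (simp add: mult_ac)
  next
    case False
    then show ?thesis using M by (auto simp: bump_def)
  qed
  then show ?thesis by blast
qed

text \<open>
  Inside the interval this is the quotient rule over the common denominator \<open>q\<^bsup>k+2\<^esup>\<close>; elsewhere, end
  points included, the quadratic bound forces derivative \<open>0\<close>.
\<close>

lemma bump_DERIV:
  defines "q \<equiv> \<lambda>a b. [:- a, 1:] * [:b, - 1:]"
  shows "(bump a b p k has_real_derivative
           bump a b (pderiv p * (q a b)\<^sup>2 - smult (real k) (p * pderiv (q a b) * q a b) + p * pderiv (q a b))
             (k + 2) x) (at x)"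
    (is "(_ has_real_derivative bump a b ?p' _ x) _")
proof (cases "a < x \<and> x < b")
  case True
  let ?q = "poly (q a b)"
  have q: "?q y = (y - a) * (b - y)" for y by (simp add: q_def algebra_simps)
  have qx: "?q x > 0" using True by (simp add: q)
  have "((\<lambda>x. poly p x / ?q x ^ k * exp (- 1 / ?q x)) has_real_derivative
      (poly (pderiv p) x * ?q x ^ k - poly p x * (real k * (poly (pderiv (q a b)) x * ?q x ^ (k - Suc 0)))) / (?q x ^ k * ?q x ^ k)
        * exp (- 1 / ?q x)
      + exp (- 1 / ?q x) * (poly (pderiv (q a b)) x / (?q x * ?q x)) * (poly p x / ?q x ^ k)) (at x)"
    using qx by (auto intro!: derivative_eq_intros poly_DERIV simp: field_simps)
  also have "(poly (pderiv p) x * ?q x ^ k - poly p x * (real k * (poly (pderiv (q a b)) x * ?q x ^ (k - Suc 0)))) / (?q x ^ k * ?q x ^ k)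
        * exp (- 1 / ?q x)
      + exp (- 1 / ?q x) * (poly (pderiv (q a b)) x / (?q x * ?q x)) * (poly p x / ?q x ^ k)
      = poly ?p' x / ?q x ^ (k + 2) * exp (- 1 / ?q x)"
    using qx by (cases k) (simp_all add: field_simps power2_eq_square)
  finally have D: "((\<lambda>x. poly p x / ?q x ^ k * exp (- 1 / ?q x)) has_real_derivative
      bump a b ?p' (k + 2) x) (at x)"
    using True by (simp add: bump_def q)
  show ?thesis
  proof (rule has_field_derivative_transform_within_open[OF D])
    show "open {a<..<b}" "x \<in> {a<..<b}" using True by auto
  qed (simp add: bump_def q)
next
  case False
  obtain K where "\<forall>y. \<bar>bump a b p k y\<bar> \<le> K * (y - x)\<^sup>2"
    using bump_quadratic_bound[OF False] by blast
  then have "(bump a b p k has_real_derivative 0) (at x)"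
    by (intro DERIV_zero_if_quadratic_bound) blast
  moreover have "bump a b ?p' (k + 2) x = 0" using False by (auto simp: bump_def)
  ultimately show ?thesis by metis
qed

lemma bump_test_function: "test_function (bump a b p k)"
proof -
  have "\<exists>p' k'. (deriv ^^ n) (bump a b p k) = bump a b p' k'" for n
  proof (induction n)
    case 0
    show ?case by auto
  next
    case (Suc n)
    then obtain p' k' where "(deriv ^^ n) (bump a b p k) = bump a b p' k'" by blast
    then have "(deriv ^^ Suc n) (bump a b p k) = deriv (bump a b p' k')" by simp
    moreover have "\<exists>p'' k''. deriv (bump a b p' k') = bump a b p'' k''"
      using DERIV_imp_deriv[OF bump_DERIV] by blast
    ultimately show ?case by metis
  qed
  moreover have "bump a b p' k' field_differentiable at x" for p' k' x
    unfolding field_differentiable_def by (rule exI, rule bump_DERIV)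
  moreover have "bounded {x. bump a b p k x \<noteq> 0}"
    by (rule bounded_subset[of "{a..b}"]) (auto simp: bump_def split: if_splits)
  ultimately show ?thesis
    unfolding test_function_def by (metis compact_closure)
qed

lemma test_function_derivatives:
  assumes "test_function \<phi>"
  shows "(\<phi> has_real_derivative deriv \<phi> x) (at x)"
    and "(deriv \<phi> has_real_derivative deriv (deriv \<phi>) x) (at x)"
    and "continuous_on UNIV \<phi>" and "continuous_on UNIV (deriv \<phi>)"
    and "continuous_on UNIV (deriv (deriv \<phi>))"
proof -
  have *: "(deriv ^^ n) \<phi> field_differentiable at x" for n x
    using assms by (auto simp: test_function_def)
  have d: "\<phi> field_differentiable at x" "deriv \<phi> field_differentiable at x"
    "deriv (deriv \<phi>) field_differentiable at x" for x
    using *[of 0 x] *[of 1 x] *[of 2 x] by (simp_all add: numeral_2_eq_2)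
  show "(\<phi> has_real_derivative deriv \<phi> x) (at x)"
    "(deriv \<phi> has_real_derivative deriv (deriv \<phi>) x) (at x)"
    using d[of x] by (simp_all add: DERIV_deriv_iff_field_differentiable)
  show "continuous_on UNIV \<phi>" "continuous_on UNIV (deriv \<phi>)"
    "continuous_on UNIV (deriv (deriv \<phi>))"
    using d by (auto intro!: continuous_at_imp_continuous_on field_differentiable_imp_continuous_at)
qed

lemma test_function_vanishes:
  assumes "test_function \<phi>"
  obtains R where "R > r"
    "\<And>x. \<bar>x\<bar> \<ge> R \<Longrightarrow> \<phi> x = 0" "\<And>x. \<bar>x\<bar> \<ge> R \<Longrightarrow> deriv \<phi> x = 0"
    "\<And>x. \<bar>x\<bar> \<ge> R \<Longrightarrow> deriv (deriv \<phi>) x = 0"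
proof -
  have "bounded {x. \<phi> x \<noteq> 0}"
    using assms closure_subset unfolding test_function_def
    by (meson bounded_subset compact_imp_bounded)
  then obtain B where B: "\<And>x. \<phi> x \<noteq> 0 \<Longrightarrow> \<bar>x\<bar> \<le> B" by (auto simp: bounded_iff)
  let ?U = "{x::real. \<bar>x\<bar> > B}"
  have U: "open ?U" by (intro open_Collect_less continuous_intros)
  have 0: "\<phi> x = 0" if "x \<in> ?U" for x using that B[of x] by auto
  have 1: "deriv \<phi> x = 0" if "x \<in> ?U" for x
  proof -
    have "(\<phi> has_real_derivative 0) (at x)"
      by (rule has_field_derivative_transform_within_open[OF DERIV_const[of 0] U that]) (simp add: 0)
    then show ?thesis by (rule DERIV_imp_deriv)
  qed
  have 2: "deriv (deriv \<phi>) x = 0" if "x \<in> ?U" for x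
  proof -
    have "(deriv \<phi> has_real_derivative 0) (at x)"
      by (rule has_field_derivative_transform_within_open[OF DERIV_const[of 0] U that]) (simp add: 1)
    then show ?thesis by (rule DERIV_imp_deriv)
  qed
  show ?thesis
    by (rule that[of "max r B + 1"]) (auto intro!: 0 1 2)
qed

section \<open>Sums of two exponentials\<close>

definition two_exp :: "real \<Rightarrow> real \<Rightarrow> real \<Rightarrow> real \<Rightarrow> real \<Rightarrow> real" where
  "two_exp a p b q X = a * exp (p * X) + b * exp (q * X)"

lemma two_exp_DERIV [derivative_intros]:
  "(two_exp a p b q has_real_derivative two_exp (p * a) p (q * b) q X) (at X)"
  unfolding two_exp_def by (auto intro!: derivative_eq_intros simp: mult_ac)

lemma continuous_on_two_exp [continuous_intros]: "continuous_on A (two_exp a p b q)"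
  unfolding two_exp_def by (intro continuous_intros)

text \<open>
  Value and slope at a point parametrise the span of two distinct exponentials.  Read from right to
  left this constructs the next piece of a wave from the jump condition; read from left to right it
  shows that the piece is unique.
\<close>

lemma two_exp_Cauchy_data_iff:
  assumes "p \<noteq> q"
  shows "two_exp a p b q x = v \<and> two_exp (p * a) p (q * b) q x = s \<longleftrightarrow>
     a = (q * v - s) / (q - p) * exp (- p * x) \<and> b = (s - p * v) / (q - p) * exp (- q * x)"
proof -
  have "two_exp a p b q x = v \<and> two_exp (p * a) p (q * b) q x = s \<longleftrightarrow>
      a * exp (p * x) = (q * v - s) / (q - p) \<and> b * exp (q * x) = (s - p * v) / (q - p)"
    (is "?l \<longleftrightarrow> ?r")
  proof
    assume ?l
    then have "v = a * exp (p * x) + b * exp (q * x)"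
      "s = p * (a * exp (p * x)) + q * (b * exp (q * x))"
      by (simp_all add: two_exp_def mult_ac)
    then show ?r using assms by (simp add: eq_divide_eq algebra_simps)
  next
    assume r: ?r
    have "two_exp a p b q x = (q * v - s + (s - p * v)) / (q - p)"
      using r by (simp only: two_exp_def add_divide_distrib)
    also have "\<dots> = (q - p) * v / (q - p)" by (simp add: algebra_simps)
    also have "\<dots> = v" using assms by simp
    finally have v: "two_exp a p b q x = v" .
    have "two_exp (p * a) p (q * b) q x = p * (a * exp (p * x)) + q * (b * exp (q * x))"
      by (simp add: two_exp_def)
    also have "\<dots> = (p * (q * v - s) + q * (s - p * v)) / (q - p)"
      using r by (simp add: add_divide_distrib)
    also have "\<dots> = (q - p) * s / (q - p)" by (simp add: algebra_simps)
    also have "\<dots> = s" using assms by simp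
    finally show ?l using v by simp
  qed
  moreover have "c * exp y = u \<longleftrightarrow> c = u * exp (- y)" for c u y :: real
    by (auto simp: exp_minus)
  ultimately show ?thesis by simp
qed

lemma LBINT_two_exp:
  assumes "x \<le> y" "p \<noteq> 0" "q \<noteq> 0"
  shows "(LBINT X:{x..y}. two_exp a p b q X) =
    two_exp (a / p) p (b / q) q y - two_exp (a / p) p (b / q) q x"
proof -
  have "(\<integral>X. two_exp a p b q X * indicator {x..y} X \<partial>lborel) =
      two_exp (a / p) p (b / q) q y - two_exp (a / p) p (b / q) q x"
  proof (rule integral_FTC_Icc_real[OF assms(1)])
    fix X
    show "(two_exp (a / p) p (b / q) q has_real_derivative two_exp a p b q X) (at X)"
      using two_exp_DERIV[of "a / p" p "b / q" q X] assms by simp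
    show "isCont (two_exp a p b q) X"
      using continuous_on_two_exp[of UNIV] by (simp add: continuous_on_eq_continuous_at)
  qed
  then show ?thesis by (simp add: set_lebesgue_integral_def mult.commute)
qed

text \<open>
  The integrand of the weak equation is an exact derivative on each interval where the coefficient
  \<open>e = 1 - c\<close> is constant, because \<open>p\<close> and \<open>q\<close> are roots of the characteristic equation
  \<open>S - n r\<^sup>2 = e r\<close> of \<open>S V = n V'' + e V'\<close>.
\<close>

lemma two_exp_weak_form_has_integral:
  fixes n S e a b p q :: real
  assumes "x \<le> y"
    and p: "S - n * p\<^sup>2 = e * p" and q: "S - n * q\<^sup>2 = e * q"
    and \<phi>: "test_function \<phi>"
  defines "flux \<equiv> \<lambda>X. two_exp a p b q X * (e * \<phi> X - n * deriv \<phi> X) + n * two_exp (p * a) p (q * b) q X * \<phi> X"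
  shows "((\<lambda>X. S * two_exp a p b q X * \<phi> X - n * two_exp a p b q X * deriv (deriv \<phi>) X
            + e * two_exp a p b q X * deriv \<phi> X) has_integral flux y - flux x) {x..y}"
proof (rule fundamental_theorem_of_calculus[OF \<open>x \<le> y\<close>])
  fix X
  let ?E = "two_exp a p b q" and ?E1 = "two_exp (p * a) p (q * b) q"
    and ?E2 = "two_exp (p * (p * a)) p (q * (q * b)) q"
  have "S * ?E X - n * ?E2 X - e * ?E1 X =
      (S - n * p\<^sup>2 - e * p) * (a * exp (p * X)) + (S - n * q\<^sup>2 - e * q) * (b * exp (q * X))"
    by (simp add: two_exp_def algebra_simps power2_eq_square)
  then have ode: "S * ?E X = n * ?E2 X + e * ?E1 X" using p q by simp
  have "(flux has_real_derivative
      ?E1 X * (e * \<phi> X - n * deriv \<phi> X) + (e * deriv \<phi> X - n * deriv (deriv \<phi>) X) * ?E X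
      + (n * ?E2 X * \<phi> X + deriv \<phi> X * (n * ?E1 X))) (at X)"
    unfolding flux_def
    by (intro DERIV_add DERIV_mult DERIV_diff DERIV_cmult two_exp_DERIV test_function_derivatives[OF \<phi>])
  also have "?E1 X * (e * \<phi> X - n * deriv \<phi> X) + (e * deriv \<phi> X - n * deriv (deriv \<phi>) X) * ?E X
      + (n * ?E2 X * \<phi> X + deriv \<phi> X * (n * ?E1 X)) =
      S * ?E X * \<phi> X - n * ?E X * deriv (deriv \<phi>) X + e * ?E X * deriv \<phi> X"
    unfolding ode by (simp add: algebra_simps)
  finally show "(flux has_vector_derivative
      S * ?E X * \<phi> X - n * ?E X * deriv (deriv \<phi>) X + e * ?E X * deriv \<phi> X) (at X within {x..y})"
    by (metis has_real_derivative_iff_has_vector_derivative has_vector_derivative_at_within)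
qed

section \<open>Rates and signs\<close>

text \<open>
  With \<open>c = 1/\<nu>\<^sup>2\<close> this compares the square roots in \<open>\<mu>\<^sub>\<plusminus>\<close> and \<open>\<lambda>\<^sub>\<plusminus>\<close>; it decides the signs of \<open>\<tau>\<^sub>-\<^sub>-\<close>
  and \<open>\<tau>\<^sub>+\<^sub>+\<close>.
\<close>

lemma abs_sqrt_diff_less:
  fixes a b c :: real
  assumes "a > 0" "b > 0" "c > 0"
  shows "\<bar>sqrt (a\<^sup>2 + c) - sqrt (b\<^sup>2 + c)\<bar> < a + b"
proof -
  have *: "sqrt (x\<^sup>2 + c) < sqrt (y\<^sup>2 + c) + (x + y)" if "x > 0" "y > 0" for x y
  proof -
    have "sqrt (x\<^sup>2 + c) \<le> x + sqrt c"
      using that assms sqrt_add_le_add_sqrt[of "x\<^sup>2" c] by simp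
    also have "sqrt c \<le> sqrt (y\<^sup>2 + c)" by simp
    finally show ?thesis using that by simp
  qed
  show ?thesis using *[of a b] *[of b a] assms by linarith
qed

locale wave_parameters =
  fixes \<nu> \<kappa> S :: real
  assumes \<nu>: "\<nu> > 0" and \<kappa>: "0 < \<kappa>" "\<kappa> < 1" and S: "S > 0"
begin

abbreviation "lm \<equiv> lam_minus \<nu> S"
abbreviation "lp \<equiv> lam_plus \<nu> S"
abbreviation "mm \<equiv> mu_minus \<nu> \<kappa> S"
abbreviation "mp \<equiv> mu_plus \<nu> \<kappa> S"
abbreviation "\<delta> \<equiv> 1 / (\<nu>\<^sup>2 * S * \<kappa>)"

lemma lam_root: "S - \<nu>\<^sup>2 * S * lm\<^sup>2 = lm" "S - \<nu>\<^sup>2 * S * lp\<^sup>2 = lp"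
proof -
  define r where "r = sqrt ((1 / (2 * \<nu>\<^sup>2 * S))\<^sup>2 + 1 / \<nu>\<^sup>2)"
  have r: "r\<^sup>2 = (1 / (2 * \<nu>\<^sup>2 * S))\<^sup>2 + 1 / \<nu>\<^sup>2" unfolding r_def by (rule real_sqrt_pow2) simp
  have l: "lm = - (1 / (2 * \<nu>\<^sup>2 * S)) - r" "lp = - (1 / (2 * \<nu>\<^sup>2 * S)) + r"
    by (simp_all add: lam_minus_def lam_plus_def r_def)
  have *: "S - \<nu>\<^sup>2 * S * (- h + z)\<^sup>2 = - h + z"
    if "h = 1 / (2 * \<nu>\<^sup>2 * S)" "z\<^sup>2 = h\<^sup>2 + 1 / \<nu>\<^sup>2" for h z
  proof -
    have n: "\<nu>\<^sup>2 * S * h = 1 / 2" "\<nu>\<^sup>2 * (1 / \<nu>\<^sup>2) = 1" using that \<nu> S by simp_all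
    have "\<nu>\<^sup>2 * S * (- h + z)\<^sup>2 = \<nu>\<^sup>2 * S * (h\<^sup>2 + z\<^sup>2) - 2 * (\<nu>\<^sup>2 * S * h) * z"
      by (simp add: power2_eq_square algebra_simps)
    also have "\<dots> = 2 * (\<nu>\<^sup>2 * S * h) * h + S * (\<nu>\<^sup>2 * (1 / \<nu>\<^sup>2)) - 2 * (\<nu>\<^sup>2 * S * h) * z"
      unfolding that(2) by (simp add: power2_eq_square algebra_simps)
    finally show ?thesis unfolding n by simp
  qed
  show "S - \<nu>\<^sup>2 * S * lm\<^sup>2 = lm" "S - \<nu>\<^sup>2 * S * lp\<^sup>2 = lp"
    using *[of _ "- r", OF refl] *[of _ r, OF refl] r l by simp_all
qed

lemma mu_root: "S - \<nu>\<^sup>2 * S * mm\<^sup>2 = (1 - 1 / \<kappa>) * mm" "S - \<nu>\<^sup>2 * S * mp\<^sup>2 = (1 - 1 / \<kappa>) * mp"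
proof -
  define h where "h = (1 - \<kappa>) / (2 * \<nu>\<^sup>2 * S * \<kappa>)"
  define r where "r = sqrt (h\<^sup>2 + 1 / \<nu>\<^sup>2)"
  have r: "r\<^sup>2 = h\<^sup>2 + 1 / \<nu>\<^sup>2" unfolding r_def by (rule real_sqrt_pow2) simp
  have l: "mm = h - r" "mp = h + r" by (simp_all add: mu_minus_def mu_plus_def r_def h_def)
  define e where "e = 1 - 1 / \<kappa>"
  have *: "S - \<nu>\<^sup>2 * S * (h + z)\<^sup>2 = e * (h + z)" if "z\<^sup>2 = h\<^sup>2 + 1 / \<nu>\<^sup>2" for z
  proof -
    have n: "\<nu>\<^sup>2 * S * h = - (e / 2)" "\<nu>\<^sup>2 * (1 / \<nu>\<^sup>2) = 1"
      using \<nu> S \<kappa> by (simp_all add: h_def e_def field_simps)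
    have "\<nu>\<^sup>2 * S * (h + z)\<^sup>2 = \<nu>\<^sup>2 * S * (h\<^sup>2 + z\<^sup>2) + 2 * (\<nu>\<^sup>2 * S * h) * z"
      by (simp add: power2_eq_square algebra_simps)
    also have "\<dots> = 2 * (\<nu>\<^sup>2 * S * h) * h + S * (\<nu>\<^sup>2 * (1 / \<nu>\<^sup>2)) + 2 * (\<nu>\<^sup>2 * S * h) * z"
      unfolding that by (simp add: power2_eq_square algebra_simps)
    finally show ?thesis unfolding n by (simp add: algebra_simps)
  qed
  show "S - \<nu>\<^sup>2 * S * mm\<^sup>2 = (1 - 1 / \<kappa>) * mm" "S - \<nu>\<^sup>2 * S * mp\<^sup>2 = (1 - 1 / \<kappa>) * mp"
    using *[of "- r"] *[of r] r l by (simp_all add: e_def)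
qed

lemma rate_signs: "lm < 0" "0 < lp" "mm < 0" "0 < mp"
proof -
  have *: "sqrt (x\<^sup>2 + 1 / \<nu>\<^sup>2) > \<bar>x\<bar>" for x
  proof -
    have "sqrt (x\<^sup>2) < sqrt (x\<^sup>2 + 1 / \<nu>\<^sup>2)" using \<nu> by (intro real_sqrt_less_mono) simp
    then show ?thesis by simp
  qed
  define a where "a = (1 - \<kappa>) / (2 * \<nu>\<^sup>2 * S * \<kappa>)"
  define b where "b = 1 / (2 * \<nu>\<^sup>2 * S)"
  have pos: "a > 0" "b > 0" using \<nu> \<kappa> S by (simp_all add: a_def b_def)
  have l: "lm = - b - sqrt (b\<^sup>2 + 1 / \<nu>\<^sup>2)" "lp = - b + sqrt (b\<^sup>2 + 1 / \<nu>\<^sup>2)"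
    "mm = a - sqrt (a\<^sup>2 + 1 / \<nu>\<^sup>2)" "mp = a + sqrt (a\<^sup>2 + 1 / \<nu>\<^sup>2)"
    by (simp_all add: lam_minus_def lam_plus_def mu_minus_def mu_plus_def a_def b_def)
  show "lm < 0" "0 < lp" "mm < 0" "0 < mp"
    unfolding l using *[of a] *[of b] pos by - (linarith+)
qed

text \<open>
  Half of the jump rate \<open>\<delta>\<close> is the sum of \<open>a = (1 - \<kappa>) / (2 \<nu>\<^sup>2 S \<kappa>)\<close> and \<open>b = 1 / (2 \<nu>\<^sup>2 S)\<close>, the
  absolute values of the parts of the rates outside the square roots.  Hence each \<open>\<tau>\<close> equals \<open>\<plusminus> sqrt (a\<^sup>2 + 1/\<nu>\<^sup>2) \<plusminus> sqrt (b\<^sup>2 + 1/\<nu>\<^sup>2) - (a + b)\<close>.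
\<close>

lemma tau_signs:
  "tau_mm \<nu> \<kappa> S < 0" "0 < tau_mp \<nu> \<kappa> S" "tau_pm \<nu> \<kappa> S < 0" "tau_pp \<nu> \<kappa> S < 0"
proof -
  define a where "a = (1 - \<kappa>) / (2 * \<nu>\<^sup>2 * S * \<kappa>)"
  define b where "b = 1 / (2 * \<nu>\<^sup>2 * S)"
  have pos: "a > 0" "b > 0" "1 / \<nu>\<^sup>2 > 0" using \<nu> \<kappa> S by (simp_all add: a_def b_def)
  have ab: "\<delta> = 2 * (a + b)" using \<nu> \<kappa> S by (simp add: a_def b_def field_simps)
  define ra where "ra = sqrt (a\<^sup>2 + 1 / \<nu>\<^sup>2)"
  define rb where "rb = sqrt (b\<^sup>2 + 1 / \<nu>\<^sup>2)"
  have r: "ra > a" "rb > b"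
    unfolding ra_def rb_def using pos by (auto intro!: real_less_rsqrt)
  have "\<bar>ra - rb\<bar> < a + b"
    unfolding ra_def rb_def by (rule abs_sqrt_diff_less[OF pos])
  then have d: "ra - rb < a + b" "rb - ra < a + b" by linarith+
  have l: "lm = - b - rb" "lp = - b + rb" "mm = a - ra" "mp = a + ra"
    by (simp_all add: lam_minus_def lam_plus_def mu_minus_def mu_plus_def ra_def rb_def a_def b_def)
  show "tau_mm \<nu> \<kappa> S < 0" "0 < tau_mp \<nu> \<kappa> S" "tau_pm \<nu> \<kappa> S < 0" "tau_pp \<nu> \<kappa> S < 0"
    unfolding tau_mm_def tau_mp_def tau_pm_def tau_pp_def l ab using r d pos(1,2) by (simp_all add: algebra_simps)
qed

section \<open>The weak equation as a jump condition\<close>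

text \<open>
  The derivative conditions at \<open>-\<Xi>\<close> and \<open>\<Xi>\<close>; the value of the wave at both points is taken from the
  inner piece.
\<close>

definition jumps :: "real \<Rightarrow> real \<Rightarrow> real \<Rightarrow> real \<Rightarrow> real \<Rightarrow> real \<Rightarrow> real \<Rightarrow> bool" where
  "jumps \<Xi> Am Ap Bm Bp Cm Cp \<longleftrightarrow>
     two_exp (lm * Am) lm (lp * Ap) lp (- \<Xi>) =
       two_exp (mm * Bm) mm (mp * Bp) mp (- \<Xi>) - \<delta> * two_exp Bm mm Bp mp (- \<Xi>) \<and>
     two_exp (lm * Cm) lm (lp * Cp) lp \<Xi> =
       two_exp (mm * Bm) mm (mp * Bp) mp \<Xi> - \<delta> * two_exp Bm mm Bp mp \<Xi>"

lemma has_coefficients_iff_two_exp: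
  "has_coefficients \<nu> \<kappa> S \<Xi> V Am Ap Bm Bp Cm Cp \<longleftrightarrow>
     (\<forall>X\<in>{..-\<Xi>}. V X = two_exp Am lm Ap lp X) \<and>
     (\<forall>X\<in>{-\<Xi>..\<Xi>}. V X = two_exp Bm mm Bp mp X) \<and>
     (\<forall>X\<in>{\<Xi>..}. V X = two_exp Cm lm Cp lp X)"
  by (simp add: has_coefficients_def two_exp_def)

lemma has_coefficients_continuous:
  assumes V: "has_coefficients \<nu> \<kappa> S \<Xi> V Am Ap Bm Bp Cm Cp"
  shows "continuous_on UNIV V"
proof -
  have "continuous_on {..-\<Xi>} V" "continuous_on {-\<Xi>..\<Xi>} V" "continuous_on {\<Xi>..} V"
    using V unfolding has_coefficients_iff_two_exp
    by (auto intro: continuous_on_eq[OF continuous_on_two_exp])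
  then have "continuous_on ({..-\<Xi>} \<union> {-\<Xi>..\<Xi>} \<union> {\<Xi>..}) V"
    by (intro continuous_on_closed_Un) auto
  moreover have "{..-\<Xi>} \<union> {-\<Xi>..\<Xi>} \<union> {\<Xi>..} = UNIV" by auto
  ultimately show ?thesis by metis
qed

text \<open>
  All terms containing \<open>deriv \<phi>\<close> at \<open>\<plusminus>\<Xi>\<close> cancel because \<open>V\<close> is continuous there, and those at the ends
  of the support vanish.  What survives are the defects in the two jump conditions, with weights
  \<open>\<phi> (-\<Xi>)\<close> and \<open>\<phi> \<Xi>\<close>.
\<close>

lemma weak_form_eq:
  assumes "\<Xi> > 0" and V: "has_coefficients \<nu> \<kappa> S \<Xi> V Am Ap Bm Bp Cm Cp"
    and \<phi>: "test_function \<phi>"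
  shows "(LBINT X. S * V X * \<phi> X - \<nu>\<^sup>2 * S * V X * deriv (deriv \<phi>) X)
      + (LBINT X. (V X - coef \<kappa> \<Xi> X * V X) * deriv \<phi> X) =
    \<nu>\<^sup>2 * S * (\<phi> (- \<Xi>) * (two_exp (lm * Am) lm (lp * Ap) lp (- \<Xi>)
        - (two_exp (mm * Bm) mm (mp * Bp) mp (- \<Xi>) - \<delta> * two_exp Bm mm Bp mp (- \<Xi>)))
      - \<phi> \<Xi> * (two_exp (lm * Cm) lm (lp * Cp) lp \<Xi>
        - (two_exp (mm * Bm) mm (mp * Bp) mp \<Xi> - \<delta> * two_exp Bm mm Bp mp \<Xi>)))"
    (is "(LBINT X. ?f X) + (LBINT X. ?g X) = ?J")
proof -
  obtain R where R: "R > \<Xi>" "\<And>x. \<bar>x\<bar> \<ge> R \<Longrightarrow> \<phi> x = 0" "\<And>x. \<bar>x\<bar> \<ge> R \<Longrightarrow> deriv \<phi> x = 0"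
    "\<And>x. \<bar>x\<bar> \<ge> R \<Longrightarrow> deriv (deriv \<phi>) x = 0"
    using test_function_vanishes[OF \<phi>] by blast
  have VA: "V X = two_exp Am lm Ap lp X" if "X \<le> - \<Xi>" for X
    using V that by (auto simp: has_coefficients_iff_two_exp)
  have VB: "V X = two_exp Bm mm Bp mp X" if "- \<Xi> \<le> X" "X \<le> \<Xi>" for X
    using V that by (auto simp: has_coefficients_iff_two_exp)
  have VC: "V X = two_exp Cm lm Cp lp X" if "\<Xi> \<le> X" for X
    using V that by (auto simp: has_coefficients_iff_two_exp)
  note cont = has_coefficients_continuous[OF V] test_function_derivatives(3-5)[OF \<phi>]
  have supp: "integrable lborel h"
    if "continuous_on UNIV h" "\<And>x. \<bar>x\<bar> \<ge> R \<Longrightarrow> h x = 0" for h :: "real \<Rightarrow> real"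
  proof -
    have "integrable lborel (\<lambda>x. indicator {-R..R} x *\<^sub>R h x)"
      by (rule borel_integrable_compact[OF compact_Icc])
        (rule continuous_on_subset[OF that(1)], simp)
    moreover have "(\<lambda>x. indicator {-R..R} x *\<^sub>R h x) = h"
    proof
      fix x show "indicator {-R..R} x *\<^sub>R h x = h x"
        using that(2)[of x] by (cases "x \<in> {-R..R}") auto
    qed
    ultimately show ?thesis by simp
  qed
  have f: "integrable lborel ?f"
    using cont R by (intro supp continuous_intros) auto
  have Vd: "integrable lborel (\<lambda>X. V X * deriv \<phi> X)"
    using cont R by (intro supp continuous_intros) auto
  have "?g = (\<lambda>X. V X * deriv \<phi> X - 1 / \<kappa> * (indicator {-\<Xi>..\<Xi>} X *\<^sub>R (V X * deriv \<phi> X)))"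
    by (auto simp: fun_eq_iff coef_def indicator_def algebra_simps)
  moreover have "integrable lborel \<dots>"
    by (intro Bochner_Integration.integrable_diff Vd integrable_mult_right integrable_mult_indicator) auto
  ultimately have g: "integrable lborel ?g" by simp
  let ?h = "\<lambda>X. ?f X + ?g X"
  have "(LBINT X. ?f X) + (LBINT X. ?g X) = (LBINT X. ?h X)"
    using f g by simp
  also have "\<dots> = integral UNIV ?h"
    using f g by (intro integral_lborel[symmetric]) auto
  also have "(?h has_integral ?J) UNIV"
  proof -
    note piece = two_exp_weak_form_has_integral[OF _ _ _ \<phi>, of _ _ S "\<nu>\<^sup>2 * S"]
    let ?flux = "\<lambda>e a p b q X. two_exp a p b q X * (e * \<phi> X - \<nu>\<^sup>2 * S * deriv \<phi> X)
      + \<nu>\<^sup>2 * S * two_exp (p * a) p (q * b) q X * \<phi> X"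
    \<comment> \<open>The outer pieces contain the points \<open>\<plusminus>\<Xi>\<close>, where \<open>coef\<close> already has its inner value.\<close>
    have l: "(?h has_integral ?flux 1 Am lm Ap lp (- \<Xi>) - ?flux 1 Am lm Ap lp (- R)) {-R..-\<Xi>}"
      by (rule has_integral_spike_finite[where S = "{-\<Xi>}", OF _ _ piece[of "-R" "-\<Xi>" lm 1 lp Am Ap]])
        (use R lam_root VA in \<open>auto simp: coef_def algebra_simps\<close>)
    have m: "(?h has_integral ?flux (1 - 1 / \<kappa>) Bm mm Bp mp \<Xi> - ?flux (1 - 1 / \<kappa>) Bm mm Bp mp (- \<Xi>)) {-\<Xi>..\<Xi>}"
      by (rule has_integral_eq[OF _ piece[of "-\<Xi>" "\<Xi>" mm "1 - 1 / \<kappa>" mp Bm Bp]])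
        (use \<open>\<Xi> > 0\<close> mu_root VB in \<open>auto simp: coef_def algebra_simps\<close>)
    have r: "(?h has_integral ?flux 1 Cm lm Cp lp R - ?flux 1 Cm lm Cp lp \<Xi>) {\<Xi>..R}"
      by (rule has_integral_spike_finite[where S = "{\<Xi>}", OF _ _ piece[of "\<Xi>" "R" lm 1 lp Cm Cp]])
        (use R \<open>\<Xi> > 0\<close> lam_root VC in \<open>auto simp: coef_def algebra_simps\<close>)
    have A: "two_exp Am lm Ap lp (- \<Xi>) = two_exp Bm mm Bp mp (- \<Xi>)"
      using VA[of "-\<Xi>"] VB[of "-\<Xi>"] \<open>\<Xi> > 0\<close> by simp
    have C: "two_exp Cm lm Cp lp \<Xi> = two_exp Bm mm Bp mp \<Xi>"
      using VC[of \<Xi>] VB[of \<Xi>] \<open>\<Xi> > 0\<close> by simp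
    have \<delta>: "\<nu>\<^sup>2 * S * (\<delta> * z) = 1 / \<kappa> * z" for z
      using \<nu> S \<kappa> by simp
    have "(?h has_integral ?flux 1 Am lm Ap lp (- \<Xi>) - ?flux 1 Am lm Ap lp (- R) +
        (?flux (1 - 1 / \<kappa>) Bm mm Bp mp \<Xi> - ?flux (1 - 1 / \<kappa>) Bm mm Bp mp (- \<Xi>)) +
        (?flux 1 Cm lm Cp lp R - ?flux 1 Cm lm Cp lp \<Xi>)) {-R..R}"
      using R \<open>\<Xi> > 0\<close> by (intro has_integral_combine[OF _ _ _ r] has_integral_combine[OF _ _ l m]) auto
    also have "?flux 1 Am lm Ap lp (- \<Xi>) - ?flux 1 Am lm Ap lp (- R) +
        (?flux (1 - 1 / \<kappa>) Bm mm Bp mp \<Xi> - ?flux (1 - 1 / \<kappa>) Bm mm Bp mp (- \<Xi>)) +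
        (?flux 1 Cm lm Cp lp R - ?flux 1 Cm lm Cp lp \<Xi>) = ?J"
    proof -
      have R0: "\<phi> R = 0" "\<phi> (- R) = 0" "deriv \<phi> R = 0" "deriv \<phi> (- R) = 0"
        using R \<open>\<Xi> > 0\<close> by auto
      have J: "?J = \<phi> (- \<Xi>) * (\<nu>\<^sup>2 * S * two_exp (lm * Am) lm (lp * Ap) lp (- \<Xi>)
          - \<nu>\<^sup>2 * S * two_exp (mm * Bm) mm (mp * Bp) mp (- \<Xi>) + \<nu>\<^sup>2 * S * (\<delta> * two_exp Bm mm Bp mp (- \<Xi>)))
        - \<phi> \<Xi> * (\<nu>\<^sup>2 * S * two_exp (lm * Cm) lm (lp * Cp) lp \<Xi>
          - \<nu>\<^sup>2 * S * two_exp (mm * Bm) mm (mp * Bp) mp \<Xi> + \<nu>\<^sup>2 * S * (\<delta> * two_exp Bm mm Bp mp \<Xi>))"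
        by (simp only: algebra_simps)
      show ?thesis unfolding J \<delta> A C R0 by (simp only: algebra_simps)
    qed
    finally have "(?h has_integral ?J) {-R..R}" .
    then show ?thesis
      by (rule has_integral_on_superset) (use R in auto)
  qed
  then have "integral UNIV ?h = ?J" by (rule integral_unique)
  finally show ?thesis .
qed

text \<open>
  The two defects can be tested separately, since a bump may be nonzero at one interface and
  vanish at the other.
\<close>

lemma weak_wave_equation_iff_jumps:
  assumes "\<Xi> > 0" and V: "has_coefficients \<nu> \<kappa> S \<Xi> V Am Ap Bm Bp Cm Cp"
  shows "weak_wave_equation \<nu> \<kappa> S \<Xi> V \<longleftrightarrow> jumps \<Xi> Am Ap Bm Bp Cm Cp"
proof -
  let ?l = "two_exp (lm * Am) lm (lp * Ap) lp (- \<Xi>)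
        - (two_exp (mm * Bm) mm (mp * Bp) mp (- \<Xi>) - \<delta> * two_exp Bm mm Bp mp (- \<Xi>))"
  let ?r = "two_exp (lm * Cm) lm (lp * Cp) lp \<Xi>
        - (two_exp (mm * Bm) mm (mp * Bp) mp \<Xi> - \<delta> * two_exp Bm mm Bp mp \<Xi>)"
  have n: "\<nu>\<^sup>2 * S \<noteq> 0" using \<nu> S by simp
  have "weak_wave_equation \<nu> \<kappa> S \<Xi> V \<longleftrightarrow>
      (\<forall>\<phi>. test_function \<phi> \<longrightarrow> \<phi> (- \<Xi>) * ?l - \<phi> \<Xi> * ?r = 0)"
    unfolding weak_wave_equation_def eq_neg_iff_add_eq_0
    using weak_form_eq[OF assms] n by simp
  also have "\<dots> \<longleftrightarrow> ?l = 0 \<and> ?r = 0"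
  proof safe
    assume *: "\<forall>\<phi>. test_function \<phi> \<longrightarrow> \<phi> (- \<Xi>) * ?l - \<phi> \<Xi> * ?r = 0"
    \<comment> \<open>A bump on \<open>(0, 2\<Xi>)\<close> sees \<open>\<Xi>\<close> but not \<open>-\<Xi>\<close>.\<close>
    show "?r = 0"
      using *[rule_format, OF bump_test_function[of 0 "2 * \<Xi>" 1 0]] \<open>\<Xi> > 0\<close>
      by (simp add: bump_def)
    show "?l = 0"
      using *[rule_format, OF bump_test_function[of "- 2 * \<Xi>" 0 1 0]] \<open>\<Xi> > 0\<close>
      by (simp add: bump_def)
  next
    fix \<phi> assume "?l = 0" "?r = 0"
    then show "\<phi> (- \<Xi>) * ?l - \<phi> \<Xi> * ?r = 0" by simp
  qed
  finally show ?thesis by (simp add: jumps_def)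
qed

lemma traveling_wave_iff:
  assumes "\<Xi> > 0" and V: "has_coefficients \<nu> \<kappa> S \<Xi> V Am Ap Bm Bp Cm Cp"
  shows "traveling_wave \<nu> \<kappa> S \<Xi> V \<longleftrightarrow>
    jumps \<Xi> Am Ap Bm Bp Cm Cp \<and> (\<forall>X. V X \<ge> 0) \<and>
    two_exp (Bm / mm) mm (Bp / mp) mp \<Xi> - two_exp (Bm / mm) mm (Bp / mp) mp (- \<Xi>) = 2 * \<kappa>"
proof -
  have "(LBINT X:{-\<Xi>..\<Xi>}. V X) = (LBINT X:{-\<Xi>..\<Xi>}. two_exp Bm mm Bp mp X)"
    using V by (intro set_lebesgue_integral_cong) (auto simp: has_coefficients_iff_two_exp)
  also have "\<dots> = two_exp (Bm / mm) mm (Bp / mp) mp \<Xi> - two_exp (Bm / mm) mm (Bp / mp) mp (- \<Xi>)"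
    using rate_signs \<open>\<Xi> > 0\<close> by (intro LBINT_two_exp) auto
  finally show ?thesis
    using has_coefficients_continuous[OF V] weak_wave_equation_iff_jumps[OF assms]
    by (simp add: traveling_wave_def)
qed

lemma has_coefficients_match:
  assumes "\<Xi> > 0" and V: "has_coefficients \<nu> \<kappa> S \<Xi> V Am Ap Bm Bp Cm Cp"
  shows "two_exp Am lm Ap lp (- \<Xi>) = two_exp Bm mm Bp mp (- \<Xi>)"
    and "two_exp Cm lm Cp lp \<Xi> = two_exp Bm mm Bp mp \<Xi>"
proof -
  have pts: "- \<Xi> \<in> {..-\<Xi>}" "- \<Xi> \<in> {-\<Xi>..\<Xi>}" "\<Xi> \<in> {-\<Xi>..\<Xi>}" "\<Xi> \<in> {\<Xi>..}"
    using \<open>\<Xi> > 0\<close> by auto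
  have "V (- \<Xi>) = two_exp Am lm Ap lp (- \<Xi>)" "V (- \<Xi>) = two_exp Bm mm Bp mp (- \<Xi>)"
    "V \<Xi> = two_exp Cm lm Cp lp \<Xi>" "V \<Xi> = two_exp Bm mm Bp mp \<Xi>"
    using V pts unfolding has_coefficients_iff_two_exp by blast+
  then show "two_exp Am lm Ap lp (- \<Xi>) = two_exp Bm mm Bp mp (- \<Xi>)"
    and "two_exp Cm lm Cp lp \<Xi> = two_exp Bm mm Bp mp \<Xi>" by simp_all
qed

text \<open>
  With \<open>B\<^sub>- = \<sigma> B\<^sub>+\<close> the integral over the inner interval is linear in \<open>B\<^sub>+\<close>, so the constraint \<open>2 \<kappa> \<noteq> 0\<close>
  determines \<open>B\<^sub>+\<close>.  Continuity and the jump conditions then give Cauchy data for the two outer pieces.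
\<close>

lemma is_wave_unique:
  assumes "\<Xi> > 0" and V: "is_wave \<nu> \<kappa> S \<Xi> \<sigma> V" and W: "is_wave \<nu> \<kappa> S \<Xi> \<sigma> W"
  shows "V = W"
proof -
  obtain Am Ap Bm Bp Cm Cp where
    c: "has_coefficients \<nu> \<kappa> S \<Xi> V Am Ap Bm Bp Cm Cp" "Bm = \<sigma> * Bp"
    using V unfolding is_wave_def by blast
  obtain Am' Ap' Bm' Bp' Cm' Cp' where
    c': "has_coefficients \<nu> \<kappa> S \<Xi> W Am' Ap' Bm' Bp' Cm' Cp'" "Bm' = \<sigma> * Bp'"
    using W unfolding is_wave_def by blast
  have t: "jumps \<Xi> Am Ap Bm Bp Cm Cp"
    "two_exp (Bm / mm) mm (Bp / mp) mp \<Xi> - two_exp (Bm / mm) mm (Bp / mp) mp (- \<Xi>) = 2 * \<kappa>"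
    using traveling_wave_iff[OF \<open>\<Xi> > 0\<close> c(1)] V by (auto simp: is_wave_def)
  have t': "jumps \<Xi> Am' Ap' Bm' Bp' Cm' Cp'"
    "two_exp (Bm' / mm) mm (Bp' / mp) mp \<Xi> - two_exp (Bm' / mm) mm (Bp' / mp) mp (- \<Xi>) = 2 * \<kappa>"
    using traveling_wave_iff[OF \<open>\<Xi> > 0\<close> c'(1)] W by (auto simp: is_wave_def)
  define I where "I = two_exp (\<sigma> / mm) mm (1 / mp) mp \<Xi> - two_exp (\<sigma> / mm) mm (1 / mp) mp (- \<Xi>)"
  have I: "two_exp (\<sigma> * B / mm) mm (B / mp) mp \<Xi> - two_exp (\<sigma> * B / mm) mm (B / mp) mp (- \<Xi>) = B * I" for B
    by (simp add: I_def two_exp_def algebra_simps)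
  have "Bp * I = 2 * \<kappa>" "Bp' * I = 2 * \<kappa>"
    using t(2) t'(2) unfolding c(2) c'(2) I by simp_all
  moreover from this have "I \<noteq> 0" using \<kappa> by auto
  ultimately have B: "Bp' = Bp" by (metis mult_right_cancel)
  then have B': "Bm' = Bm" using c(2) c'(2) by simp
  have "lm \<noteq> lp" using rate_signs by linarith
  note data = two_exp_Cauchy_data_iff[OF this, THEN iffD1, OF conjI]
  note match = has_coefficients_match[OF \<open>\<Xi> > 0\<close> c(1)]
    has_coefficients_match[OF \<open>\<Xi> > 0\<close> c'(1), unfolded B B']
  note jump = t(1)[unfolded jumps_def] t'(1)[unfolded jumps_def B B']
  have "Am' = Am \<and> Ap' = Ap"
    using data[OF match(1) jump(1)[THEN conjunct1]] data[OF match(3) jump(2)[THEN conjunct1]] by simp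
  moreover have "Cm' = Cm \<and> Cp' = Cp"
    using data[OF match(2) jump(1)[THEN conjunct2]] data[OF match(4) jump(2)[THEN conjunct2]] by simp
  ultimately have W': "has_coefficients \<nu> \<kappa> S \<Xi> W Am Ap Bm Bp Cm Cp"
    using c'(1) B B' by simp
  show ?thesis
  proof
    fix X
    have "X \<in> {..-\<Xi>} \<or> X \<in> {-\<Xi>..\<Xi>} \<or> X \<in> {\<Xi>..}" by auto
    then show "V X = W X"
      using c(1) W' unfolding has_coefficients_iff_two_exp by (elim disjE) auto
  qed
qed

lemma wave_eqI:
  assumes "\<Xi> > 0" "is_wave \<nu> \<kappa> S \<Xi> \<sigma> V"
  shows "wave \<nu> \<kappa> S \<Xi> \<sigma> = V"
  unfolding wave_def using assms is_wave_unique by (intro the_equality) auto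

section \<open>The wave with a purely growing tail\<close>

text \<open>
  The coefficients of the inner piece as a function of \<open>X + \<Xi>\<close>, when the left tail is
  \<open>\<eta> exp (\<lambda>\<^sub>+ (X + \<Xi>))\<close>.
\<close>

definition inner_m :: "real \<Rightarrow> real" where
  "inner_m \<eta> = \<eta> * tau_pp \<nu> \<kappa> S / (mp - mm)"

definition inner_p :: "real \<Rightarrow> real" where
  "inner_p \<eta> = - \<eta> * tau_pm \<nu> \<kappa> S / (mp - mm)"

text \<open>
  The integral of the inner piece from \<open>0\<close> to \<open>T\<close>, written through its primitive.
\<close>

definition mass :: "real \<Rightarrow> real \<Rightarrow> real" where
  "mass \<eta> T = two_exp (inner_m \<eta> / mm) mm (inner_p \<eta> / mp) mp T
     - two_exp (inner_m \<eta> / mm) mm (inner_p \<eta> / mp) mp 0"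

text \<open>
  The lower end point of the admissible interval.
\<close>

definition sigma_min :: "real \<Rightarrow> real" where
  "sigma_min \<Xi> = - (tau_pp \<nu> \<kappa> S / tau_pm \<nu> \<kappa> S) * exp (- (mp - mm) * \<Xi>)"

lemma inner_signs:
  assumes "\<eta> > 0"
  shows "inner_m \<eta> < 0" "0 < inner_p \<eta>"
  using assms tau_signs rate_signs
  by (simp_all add: inner_m_def inner_p_def divide_less_0_iff zero_less_divide_iff
      mult_less_0_iff zero_less_mult_iff)

lemma sigma_min_admissible: "sigma_min \<Xi> < 0" "admissible \<nu> \<kappa> S \<Xi> (sigma_min \<Xi>)"
proof -
  show neg: "sigma_min \<Xi> < 0"
    using tau_signs by (simp add: sigma_min_def mult_less_0_iff divide_less_0_iff zero_less_divide_iff)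
  have "0 < - (tau_mp \<nu> \<kappa> S / tau_mm \<nu> \<kappa> S) * exp ((mp - mm) * \<Xi>)"
    using tau_signs by (simp add: mult_less_0_iff divide_less_0_iff)
  then show "admissible \<nu> \<kappa> S \<Xi> (sigma_min \<Xi>)"
    using neg by (simp add: admissible_def sigma_min_def)
qed

lemma sigma_min_ratio:
  "inner_m \<eta> * exp (mm * \<Xi>) = sigma_min \<Xi> * (inner_p \<eta> * exp (mp * \<Xi>))"
proof -
  have "exp (mm * \<Xi>) = exp (- (mp - mm) * \<Xi>) * exp (mp * \<Xi>)"
    by (simp add: exp_add[symmetric] algebra_simps)
  then show ?thesis
    using tau_signs rate_signs by (simp add: inner_m_def inner_p_def sigma_min_def)
qed

text \<open>
  The slope \<open>\<lambda>\<^sub>+ \<eta> + \<delta> \<eta>\<close> is that of the tail, corrected by the jump.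
\<close>

lemma inner_Cauchy_data:
  "two_exp Bm mm Bp mp (- \<Xi>) = \<eta> \<and> two_exp (mm * Bm) mm (mp * Bp) mp (- \<Xi>) = lp * \<eta> + \<delta> * \<eta>
   \<longleftrightarrow> Bm = inner_m \<eta> * exp (mm * \<Xi>) \<and> Bp = inner_p \<eta> * exp (mp * \<Xi>)"
proof -
  have "mm \<noteq> mp" using rate_signs by linarith
  moreover have "mp * \<eta> - (lp * \<eta> + \<delta> * \<eta>) = \<eta> * tau_pp \<nu> \<kappa> S"
    "lp * \<eta> + \<delta> * \<eta> - mm * \<eta> = - \<eta> * tau_pm \<nu> \<kappa> S"
    by (simp_all add: tau_pp_def tau_pm_def algebra_simps)
  ultimately show ?thesis
    by (simp add: two_exp_Cauchy_data_iff inner_m_def inner_p_def)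
qed

lemma two_exp_shift:
  "two_exp (a * exp (p * c)) p (b * exp (q * c)) q X = two_exp a p b q (X + c)"
  by (simp add: two_exp_def distrib_left exp_add mult_ac)

lemma inner_mass:
  assumes "Bm = inner_m \<eta> * exp (mm * \<Xi>)" "Bp = inner_p \<eta> * exp (mp * \<Xi>)"
  shows "two_exp (Bm / mm) mm (Bp / mp) mp \<Xi> - two_exp (Bm / mm) mm (Bp / mp) mp (- \<Xi>) = mass \<eta> (2 * \<Xi>)"
  using two_exp_shift[of "inner_m \<eta> / mm" mm \<Xi> "inner_p \<eta> / mp" mp] assms
  by (simp add: mass_def)

text \<open>
  The negative coefficient belongs to the decaying exponential and the positive one to the growing
  exponential, so both terms increase from their values at \<open>0\<close>, whose sum is \<open>\<eta>\<close>.
\<close>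

lemma inner_profile_ge:
  assumes "\<eta> > 0" "t \<ge> 0"
  shows "two_exp (inner_m \<eta>) mm (inner_p \<eta>) mp t \<ge> \<eta>"
proof -
  have "inner_m \<eta> + inner_p \<eta> = \<eta> * (tau_pp \<nu> \<kappa> S - tau_pm \<nu> \<kappa> S) / (mp - mm)"
    by (simp add: inner_m_def inner_p_def right_diff_distrib diff_divide_distrib)
  also have "\<dots> = \<eta>"
    using rate_signs by (simp add: tau_pp_def tau_pm_def)
  finally have \<eta>: "inner_m \<eta> + inner_p \<eta> = \<eta>" .
  have "inner_m \<eta> * 1 \<le> inner_m \<eta> * exp (mm * t)" "inner_p \<eta> * 1 \<le> inner_p \<eta> * exp (mp * t)"
    using inner_signs[OF assms(1)] rate_signs assms
    by (auto intro!: mult_left_mono mult_left_mono_neg simp: mult_nonpos_nonneg)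
  then show ?thesis using \<eta> by (simp add: two_exp_def)
qed

text \<open>
  The derivative of \<open>mass \<eta>\<close> is the inner profile, which is at least \<open>\<eta>\<close>.  So the mass is strictly
  increasing, and being at least \<open>\<eta> T\<close> it has reached \<open>m\<close> by \<open>T = m / \<eta>\<close>.
\<close>

lemma mass_unique_level:
  assumes "\<eta> > 0" "m > 0"
  shows "\<exists>!T. T > 0 \<and> mass \<eta> T = m"
proof -
  let ?w = "two_exp (inner_m \<eta>) mm (inner_p \<eta>) mp"
  have D: "(mass \<eta> has_real_derivative ?w T) (at T)" for T
    using two_exp_DERIV[of "inner_m \<eta> / mm" mm "inner_p \<eta> / mp" mp T] rate_signs
    by (auto simp: mass_def[abs_def] intro!: derivative_eq_intros)
  have mono: "mass \<eta> x < mass \<eta> y" if "0 \<le> x" "x < y" for x y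
  proof (rule DERIV_pos_imp_increasing[OF that(2)])
    fix t assume "x \<le> t" "t \<le> y"
    then have "?w t > 0"
      using that inner_profile_ge[OF assms(1), of t] assms(1) by simp
    then show "\<exists>d. (mass \<eta> has_real_derivative d) (at t) \<and> d > 0"
      using D by blast
  qed
  have grow: "mass \<eta> T \<ge> \<eta> * T" if "T \<ge> 0" for T
  proof -
    have "mass \<eta> 0 - \<eta> * 0 \<le> mass \<eta> T - \<eta> * T"
    proof (rule DERIV_nonneg_imp_nondecreasing[OF that])
      fix x assume "0 \<le> x" "x \<le> T"
      have "((\<lambda>T. mass \<eta> T - \<eta> * T) has_real_derivative ?w x - \<eta>) (at x)"
        by (auto intro!: derivative_eq_intros D)
      then show "\<exists>y. ((\<lambda>T. mass \<eta> T - \<eta> * T) has_real_derivative y) (at x) \<and> y \<ge> 0"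
        using inner_profile_ge[OF assms(1) \<open>0 \<le> x\<close>] by (intro exI[of _ "?w x - \<eta>"]) simp
    qed
    then show ?thesis by (simp add: mass_def)
  qed
  have "\<exists>T\<ge>0. T \<le> m / \<eta> \<and> mass \<eta> T = m"
  proof (rule IVT)
    show "mass \<eta> 0 \<le> m" using assms by (simp add: mass_def)
    show "m \<le> mass \<eta> (m / \<eta>)" using grow[of "m / \<eta>"] assms by simp
    show "\<forall>x. 0 \<le> x \<and> x \<le> m / \<eta> \<longrightarrow> isCont (mass \<eta>) x" using D DERIV_isCont by blast
  qed (use assms in simp)
  then obtain T where T: "T \<ge> 0" "mass \<eta> T = m" by blast
  have "mass \<eta> 0 = 0" by (simp add: mass_def)
  then have "T \<noteq> 0" using T assms by auto
  show ?thesis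
  proof (intro ex1I conjI)
    show "T > 0" "mass \<eta> T = m" using T \<open>T \<noteq> 0\<close> by auto
    fix T' assume "T' > 0 \<and> mass \<eta> T' = m"
    then show "T' = T" using mono[of T T'] mono[of T' T] T by linarith
  qed
qed

text \<open>
  The tail condition allows \<open>A\<^sub>- = 0\<close>, \<open>A\<^sub>+ = \<eta> exp (\<lambda>\<^sub>+ \<Xi>)\<close> in the representation of \<open>V\<close>.  The transition
  at \<open>-\<Xi>\<close> then gives \<open>B\<^sub>\<plusminus>\<close>; their ratio is \<open>\<sigma>\<close>, and the constraint becomes a condition on
  \<open>mass\<close>.
\<close>

lemma growing_wave_determined:
  assumes "\<Xi> > 0" and V: "is_wave \<nu> \<kappa> S \<Xi> \<sigma> V"
    and tail: "\<forall>X\<le>-\<Xi>. V X = \<eta> * exp (lp * (X + \<Xi>))"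
  shows "mass \<eta> (2 * \<Xi>) = 2 * \<kappa>" "\<sigma> = sigma_min \<Xi>"
proof -
  obtain Am Ap Bm Bp Cm Cp where
    c: "has_coefficients \<nu> \<kappa> S \<Xi> V Am Ap Bm Bp Cm Cp" "Bm = \<sigma> * Bp" "Bp > 0"
    using V unfolding is_wave_def by blast
  have c0: "has_coefficients \<nu> \<kappa> S \<Xi> V 0 (\<eta> * exp (lp * \<Xi>)) Bm Bp Cm Cp"
  proof -
    have "V X = two_exp 0 lm (\<eta> * exp (lp * \<Xi>)) lp X" if "X \<in> {..-\<Xi>}" for X
      using tail[rule_format, of X] that by (simp add: two_exp_def distrib_left exp_add)
    then show ?thesis using c(1) unfolding has_coefficients_iff_two_exp by blast
  qed
  have t: "jumps \<Xi> 0 (\<eta> * exp (lp * \<Xi>)) Bm Bp Cm Cp"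
    "two_exp (Bm / mm) mm (Bp / mp) mp \<Xi> - two_exp (Bm / mm) mm (Bp / mp) mp (- \<Xi>) = 2 * \<kappa>"
    using traveling_wave_iff[OF \<open>\<Xi> > 0\<close> c0] V by (auto simp: is_wave_def)
  have "two_exp 0 lm (\<eta> * exp (lp * \<Xi>)) lp (- \<Xi>) = \<eta>"
    "two_exp (lm * 0) lm (lp * (\<eta> * exp (lp * \<Xi>))) lp (- \<Xi>) = lp * \<eta>"
    by (simp_all add: two_exp_def exp_minus)
  then have "two_exp Bm mm Bp mp (- \<Xi>) = \<eta>"
    "two_exp (mm * Bm) mm (mp * Bp) mp (- \<Xi>) = lp * \<eta> + \<delta> * \<eta>"
    using has_coefficients_match[OF \<open>\<Xi> > 0\<close> c0] t(1) unfolding jumps_def by simp_all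
  then have B: "Bm = inner_m \<eta> * exp (mm * \<Xi>)" "Bp = inner_p \<eta> * exp (mp * \<Xi>)"
    using inner_Cauchy_data by blast+
  show "mass \<eta> (2 * \<Xi>) = 2 * \<kappa>"
    using inner_mass[OF B] t(2) by simp
  show "\<sigma> = sigma_min \<Xi>"
    using sigma_min_ratio[of \<eta> \<Xi>] c(2,3) unfolding B[symmetric] by simp
qed

text \<open>
  The wave is continued from left to right: the tail gives the inner piece, and the value \<open>v\<close> and slope
  \<open>s\<close> at \<open>\<Xi> + 0\<close> give the outgoing piece.  With \<open>E\<^sub>\<plusminus> = exp (\<mu>\<^sub>\<plusminus> \<Xi>)\<close>, the coefficient \<open>C\<^sub>+\<close> has the sign of
  \<open>B\<^sub>- E\<^sub>- \<tau>\<^sub>-\<^sub>- + B\<^sub>+ E\<^sub>+ \<tau>\<^sub>-\<^sub>+\<close>, whose terms are both positive.  In \<open>C\<^sub>-\<close>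
  the terms have opposite signs, but inserting \<open>B\<^sub>\<plusminus>\<close> shows that \<open>C\<^sub>-\<close> is a positive multiple of
  \<open>\<tau>\<^sub>+\<^sub>+ \<tau>\<^sub>+\<^sub>- (E\<^sub>+\<^sup>2 - E\<^sub>-\<^sup>2)\<close>.
\<close>

lemma growing_wave_exists:
  assumes "\<Xi> > 0" "\<eta> > 0" and mass: "mass \<eta> (2 * \<Xi>) = 2 * \<kappa>"
  obtains V Ap Bm Bp Cm Cp where
    "is_wave \<nu> \<kappa> S \<Xi> (sigma_min \<Xi>) V"
    "\<forall>X\<le>-\<Xi>. V X = \<eta> * exp (lp * (X + \<Xi>))"
    "has_coefficients \<nu> \<kappa> S \<Xi> V 0 Ap Bm Bp Cm Cp"
    "0 < Ap" "Bm < 0" "0 < Bp" "Cm > 0" "Cp > 0"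
proof -
  let ?w = "two_exp (inner_m \<eta>) mm (inner_p \<eta>) mp"
  define Ap where "Ap = \<eta> * exp (lp * \<Xi>)"
  define Bm where "Bm = inner_m \<eta> * exp (mm * \<Xi>)"
  define Bp where "Bp = inner_p \<eta> * exp (mp * \<Xi>)"
  define v where "v = two_exp Bm mm Bp mp \<Xi>"
  define s where "s = two_exp (mm * Bm) mm (mp * Bp) mp \<Xi> - \<delta> * v"
  define Cm where "Cm = (lp * v - s) / (lp - lm) * exp (- lm * \<Xi>)"
  define Cp where "Cp = (s - lm * v) / (lp - lm) * exp (- lp * \<Xi>)"
  define V where "V X = (if X \<le> - \<Xi> then two_exp 0 lm Ap lp X
    else if X \<le> \<Xi> then two_exp Bm mm Bp mp X else two_exp Cm lm Cp lp X)" for X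
  have "lm \<noteq> lp" using rate_signs by linarith
  have A: "two_exp 0 lm Ap lp (- \<Xi>) = \<eta>" "two_exp (lm * 0) lm (lp * Ap) lp (- \<Xi>) = lp * \<eta>"
    by (simp_all add: Ap_def two_exp_def exp_minus)
  have B: "two_exp Bm mm Bp mp (- \<Xi>) = \<eta>"
    "two_exp (mm * Bm) mm (mp * Bp) mp (- \<Xi>) = lp * \<eta> + \<delta> * \<eta>"
    using inner_Cauchy_data[of Bm Bp \<Xi> \<eta>] by (simp_all add: Bm_def Bp_def)
  have C: "two_exp Cm lm Cp lp \<Xi> = v" "two_exp (lm * Cm) lm (lp * Cp) lp \<Xi> = s"
    using two_exp_Cauchy_data_iff[OF \<open>lm \<noteq> lp\<close>, of Cm Cp \<Xi> v s] by (simp_all add: Cm_def Cp_def)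
  have signs: "0 < Ap" "Bm < 0" "0 < Bp"
    using inner_signs[OF \<open>\<eta> > 0\<close>] \<open>\<eta> > 0\<close> by (simp_all add: Ap_def Bm_def Bp_def mult_neg_pos)
  have "s - lm * v = Bm * exp (mm * \<Xi>) * tau_mm \<nu> \<kappa> S + Bp * exp (mp * \<Xi>) * tau_mp \<nu> \<kappa> S"
    by (simp add: s_def v_def two_exp_def tau_mm_def tau_mp_def algebra_simps)
  also have "\<dots> > 0"
    using signs tau_signs by (intro add_pos_pos mult_neg_neg mult_pos_pos) (auto simp: mult_neg_pos)
  finally have Cp: "Cp > 0" using rate_signs by (simp add: Cp_def)
  have "lp * v - s = - (Bm * exp (mm * \<Xi>) * tau_pm \<nu> \<kappa> S + Bp * exp (mp * \<Xi>) * tau_pp \<nu> \<kappa> S)"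
    by (simp add: s_def v_def two_exp_def tau_pm_def tau_pp_def algebra_simps)
  also have "\<dots> = \<eta> / (mp - mm) * (tau_pp \<nu> \<kappa> S * tau_pm \<nu> \<kappa> S)
      * (exp (mp * \<Xi>) * exp (mp * \<Xi>) - exp (mm * \<Xi>) * exp (mm * \<Xi>))"
    by (simp add: Bm_def Bp_def inner_m_def inner_p_def algebra_simps)
  also have "\<dots> > 0"
  proof (intro mult_pos_pos[OF mult_pos_pos] mult_neg_neg tau_signs(3,4))
    have "exp (mm * \<Xi>) < exp (mp * \<Xi>)" using rate_signs \<open>\<Xi> > 0\<close> by simp
    then show "0 < exp (mp * \<Xi>) * exp (mp * \<Xi>) - exp (mm * \<Xi>) * exp (mm * \<Xi>)"
      by (simp add: mult_strict_mono)
  qed (use rate_signs \<open>\<eta> > 0\<close> in auto)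
  finally have Cm: "Cm > 0" using rate_signs by (simp add: Cm_def)
  have coeffs: "has_coefficients \<nu> \<kappa> S \<Xi> V 0 Ap Bm Bp Cm Cp"
    unfolding has_coefficients_iff_two_exp
  proof (intro conjI ballI)
    fix X assume "X \<in> {- \<Xi>..\<Xi>}"
    then show "V X = two_exp Bm mm Bp mp X"
      using A B by (cases "X = - \<Xi>") (auto simp: V_def)
  next
    fix X assume "X \<in> {\<Xi>..}"
    then show "V X = two_exp Cm lm Cp lp X"
      using \<open>\<Xi> > 0\<close> C by (cases "X = \<Xi>") (auto simp: V_def v_def)
  qed (simp add: V_def)
  have jumps: "jumps \<Xi> 0 Ap Bm Bp Cm Cp"
    unfolding jumps_def using A B C by (simp add: s_def v_def)
  have "V X \<ge> 0" for X
  proof -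
    consider "X \<le> - \<Xi>" | "- \<Xi> < X" "X \<le> \<Xi>" | "\<Xi> < X" by linarith
    then show ?thesis
    proof cases
      case 1
      then show ?thesis using signs by (simp add: V_def two_exp_def)
    next
      case 2
      then have "V X = ?w (X + \<Xi>)"
        by (simp add: V_def Bm_def Bp_def two_exp_shift)
      then show ?thesis using inner_profile_ge[OF \<open>\<eta> > 0\<close>, of "X + \<Xi>"] 2 \<open>\<eta> > 0\<close> by simp
    next
      case 3
      then show ?thesis using Cm Cp \<open>\<Xi> > 0\<close> by (simp add: V_def two_exp_def)
    qed
  qed
  then have "traveling_wave \<nu> \<kappa> S \<Xi> V"
    using traveling_wave_iff[OF \<open>\<Xi> > 0\<close> coeffs] jumps inner_mass[OF Bm_def Bp_def] mass by simp
  moreover have "Bm = sigma_min \<Xi> * Bp"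
    unfolding Bm_def Bp_def by (rule sigma_min_ratio)
  ultimately have "is_wave \<nu> \<kappa> S \<Xi> (sigma_min \<Xi>) V"
    unfolding is_wave_def using coeffs signs by blast
  moreover have "\<forall>X\<le>-\<Xi>. V X = \<eta> * exp (lp * (X + \<Xi>))"
    by (simp add: V_def Ap_def two_exp_def distrib_left exp_add)
  ultimately show ?thesis using that[OF _ _ coeffs signs Cm Cp] by simp
qed

end

lemma ex1_pairI:
  assumes "P a b" "\<And>x y. P x y \<Longrightarrow> x = a \<and> y = b"
  shows "\<exists>!(x, y). P x y"
proof (rule ex1I[of _ "(a, b)"])
  show "case (a, b) of (x, y) \<Rightarrow> P x y" using assms(1) by simp
  show "z = (a, b)" if "case z of (x, y) \<Rightarrow> P x y" for z
    using assms(2)[of "fst z" "snd z"] that by (simp add: case_prod_unfold prod_eq_iff)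
qed

theorem theorem3:
  fixes \<nu> \<kappa> S \<eta> :: real
  assumes "\<nu> > 0" and "0 < \<kappa>" and "\<kappa> < 1" and "S > 0" and "\<eta> > 0"
  shows "\<exists>!(\<Xi>, \<sigma>). \<Xi> > 0 \<and> \<sigma> < 0 \<and> admissible \<nu> \<kappa> S \<Xi> \<sigma> \<and>
    (let V = wave \<nu> \<kappa> S \<Xi> \<sigma> in
      is_wave \<nu> \<kappa> S \<Xi> \<sigma> V \<and>
      (\<forall>X\<le>-\<Xi>. V X = \<eta> * exp (lam_plus \<nu> S * (X + \<Xi>))) \<and>
      (\<exists>Am Ap Bm Bp Cm Cp. has_coefficients \<nu> \<kappa> S \<Xi> V Am Ap Bm Bp Cm Cp \<and>
         Am = 0 \<and> 0 < Ap \<and> Bm < 0 \<and> 0 < Bp \<and> Cm > 0 \<and> Cp > 0))"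
    (is "\<exists>!(\<Xi>, \<sigma>). ?P \<Xi> \<sigma>")
proof -
  interpret wave_parameters \<nu> \<kappa> S
    using assms by unfold_locales
  obtain T where T: "T > 0" "mass \<eta> T = 2 * \<kappa>"
    and T_unique: "\<And>T'. T' > 0 \<Longrightarrow> mass \<eta> T' = 2 * \<kappa> \<Longrightarrow> T' = T"
    using mass_unique_level[OF \<open>\<eta> > 0\<close>, of "2 * \<kappa>"] \<open>0 < \<kappa>\<close> by auto
  define \<Xi> where "\<Xi> = T / 2"
  have \<Xi>: "\<Xi> > 0" "mass \<eta> (2 * \<Xi>) = 2 * \<kappa>" using T by (simp_all add: \<Xi>_def)
  obtain V Ap Bm Bp Cm Cp where V: "is_wave \<nu> \<kappa> S \<Xi> (sigma_min \<Xi>) V"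
    "\<forall>X\<le>-\<Xi>. V X = \<eta> * exp (lp * (X + \<Xi>))"
    "has_coefficients \<nu> \<kappa> S \<Xi> V 0 Ap Bm Bp Cm Cp"
    "0 < Ap" "Bm < 0" "0 < Bp" "Cm > 0" "Cp > 0"
    using growing_wave_exists[OF \<Xi>(1) \<open>\<eta> > 0\<close> \<Xi>(2)] .
  have "\<exists>Am Ap Bm Bp Cm Cp. has_coefficients \<nu> \<kappa> S \<Xi> V Am Ap Bm Bp Cm Cp \<and>
      Am = 0 \<and> 0 < Ap \<and> Bm < 0 \<and> 0 < Bp \<and> Cm > 0 \<and> Cp > 0"
    by (intro exI conjI) (rule V refl)+
  then have "?P \<Xi> (sigma_min \<Xi>)"
    unfolding Let_def wave_eqI[OF \<Xi>(1) V(1)]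
    by (intro conjI \<Xi>(1) sigma_min_admissible V(1,2))
  moreover have "\<Xi>' = \<Xi> \<and> \<sigma>' = sigma_min \<Xi>" if P: "?P \<Xi>' \<sigma>'" for \<Xi>' \<sigma>'
  proof -
    have "\<Xi>' > 0" using P by (rule conjunct1)
    have W: "is_wave \<nu> \<kappa> S \<Xi>' \<sigma>' (wave \<nu> \<kappa> S \<Xi>' \<sigma>')"
      "\<forall>X\<le>-\<Xi>'. wave \<nu> \<kappa> S \<Xi>' \<sigma>' X = \<eta> * exp (lp * (X + \<Xi>'))"
      using P unfolding Let_def by simp_all
    note * = growing_wave_determined[OF \<open>\<Xi>' > 0\<close> W]
    have "2 * \<Xi>' = T" using T_unique * \<open>\<Xi>' > 0\<close> by simp
    then have "\<Xi>' = \<Xi>" by (simp add: \<Xi>_def)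
    with * show ?thesis by simp
  qed
  ultimately show ?thesis
    by (rule ex1_pairI)
qed

end
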